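(* Let $k$ be a positive integer. Then every $(k+1)$-connected $(K_2 \cup kK_1)$-free graph $G$ with $\tau(G) > 1$ and $\delta(G) \geq 2k$ is Hamilton-connected.
   Context: Graphs are finite and simple. $\delta(G)$ is the minimum degree of $G$. $K_2\cup kK_1$ denotes the disjoint union of one edge $K_2$ and $k$ isolated vertices; a graph is $(K_2\cup kK_1)$-free if it contains no induced subgraph isomorphic to $K_2\cup kK_1$. For $S\subseteq V(G)$, $\omega(G-S)$ is the number of components of $G-S$. The toughness of a non-complete graph $G$ is $\tau(G)=\min\{|S|/\omega(G-S) : S\subseteq V(G),\ \omega(G-S)\ge 2\}$, and $\tau(G)=\infty$ if $G$ is complete. A graph is $m$-connected if the removal of any set of fewer than $m$ vertices does not disconnect it. A graph is Hamilton-connected if any two distinct vertices are the endpoints of a Hamilton path (a path containing every vertex). *)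

theory Defs
  imports "Graph_Theory.Graph_Theory" "HOL-Library.Extended_Real"
begin

text \<open>
  Finite simple graphs are the symmetric, loop-free finite digraphs without parallel arcs
  (locale \<^locale>\<open>graph\<close>): every undirected edge is represented by two opposite arcs.
\<close>

definition delete_verts :: "('a,'b) pre_digraph \<Rightarrow> 'a set \<Rightarrow> ('a,'b) pre_digraph" where
  "delete_verts G S = G \<restriction> (verts G - S)"

text \<open>
  In a symmetric digraph the strongly connected components are the connected components of the
  undirected graph.
\<close>

definition num_components :: "('a,'b) pre_digraph \<Rightarrow> nat" where
  "num_components G = card (pre_digraph.sccs G)"

text \<open>
  In a symmetric digraph without parallel arcs the out-degree of a vertex is its number of
  neighbours. The value is unspecified for the graph without vertices.
\<close>

definition min_degree :: "('a,'b) pre_digraph \<Rightarrow> nat" where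
  "min_degree G = Min (out_degree G ` verts G)"

text \<open>
  No lower bound on the number of vertices is imposed: complete graphs are \<open>m\<close>-connected for
  every \<open>m\<close>. Since \<^const>\<open>connected\<close> excludes the graph without vertices, only proper subsets
  are removed.
\<close>

definition m_connected :: "nat \<Rightarrow> ('a,'b) pre_digraph \<Rightarrow> bool" where
  "m_connected m G \<longleftrightarrow>
    (\<forall>S. S \<subset> verts G \<and> card S < m \<longrightarrow> connected (delete_verts G S))"

text \<open>
  The minimum ranges over a finite set, which is nonempty if \<open>G\<close> is not complete: delete all
  vertices except two non-adjacent ones.
\<close>

definition toughness :: "('a,'b) pre_digraph \<Rightarrow> ereal" where
  "toughness G =
    (if complete_digraph (card (verts G)) G then \<infinity>
     else Min {ereal (real (card S) / real (num_components (delete_verts G S))) | S.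
                 S \<subseteq> verts G \<and> 2 \<le> num_components (delete_verts G S)})"

text \<open>The disjoint union of one edge (joining 0 and 1) and \<open>k\<close> isolated vertices.\<close>

definition K2_union_kK1 :: "nat \<Rightarrow> nat pair_pre_digraph" where
  "K2_union_kK1 k = \<lparr> pverts = {..<k + 2}, parcs = {(0, 1), (1, 0)} \<rparr>"

definition induced_free :: "('c,'d) pre_digraph \<Rightarrow> ('a,'b) pre_digraph \<Rightarrow> bool" where
  "induced_free F G \<longleftrightarrow> \<not> (\<exists>H. induced_subgraph H G \<and> digraph_iso H F)"

definition hamilton_path :: "('a,'b) pre_digraph \<Rightarrow> 'a list \<Rightarrow> bool" where
  "hamilton_path G p \<longleftrightarrow> vpath p G \<and> set p = verts G"

definition hamilton_connected :: "('a,'b) pre_digraph \<Rightarrow> bool" where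
  "hamilton_connected G \<longleftrightarrow>
    (\<forall>u \<in> verts G. \<forall>v \<in> verts G. u \<noteq> v \<longrightarrow>
      (\<exists>p. hamilton_path G p \<and> hd p = u \<and> last p = v))"

end

theory Submission
  imports Defs
begin

text \<open>
  Let \<open>p\<close> be a longest path between two given vertices and suppose that some vertex is off \<open>p\<close>.
  Rerouting \<open>p\<close> through vertices off \<open>p\<close> gives longer paths unless certain pairs of vertices of \<open>p\<close> are
  non-adjacent, and the proof lives on these non-adjacencies.

  No two vertices off \<open>p\<close> are adjacent (\<open>off_path_nonadj\<close>). Indeed, a component \<open>C\<close> of the graph
  off \<open>p\<close> has more than \<open>k\<close> neighbours on \<open>p\<close> by connectivity, the successors of these neighbours
  along \<open>p\<close> are pairwise non-adjacent and have no neighbour in \<open>C\<close>, so \<open>k\<close> of them together with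
  an edge inside \<open>C\<close> would induce \<open>K\<^sub>2 \<union> kK\<^sub>1\<close>.

  Hence all neighbours of a vertex \<open>x\<close> off \<open>p\<close> lie on \<open>p\<close>, and there are at least \<open>2k\<close> of them.
  Let \<open>S\<close> be the set of their successors along \<open>p\<close> and \<open>I = S \<union> {x}\<close>, an independent set with at
  least \<open>2k\<close> elements. Let \<open>A\<close> be the set of vertices with a neighbour in \<open>I\<close>, and \<open>J\<close> its
  complement. An edge inside \<open>J\<close> would have no end adjacent to \<open>I\<close>, so \<open>J\<close> is independent.
  A vertex \<open>a\<close> of \<open>A\<close> is non-adjacent to fewer than \<open>k\<close> elements of \<open>I\<close>: it has a neighbour
  \<open>y \<in> I\<close>, which has no neighbour in \<open>I\<close>, so the non-neighbours of \<open>a\<close> in \<open>I\<close> are isolated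
  from the edge \<open>ay\<close>. Having so many neighbours in \<open>I\<close> is impossible for two consecutive vertices
  of \<open>p\<close>: in a suitable cyclic order of \<open>S\<close>, a neighbour of the first never precedes a
  neighbour of the second, so their numbers of non-neighbours in \<open>S\<close> add up to at least
  \<open>|S| - 1\<close> (\<open>card_successors_le_missed\<close>). It is also impossible for a vertex off \<open>p\<close>, which has
  at most one neighbour in \<open>S\<close> if it is not \<open>x\<close>.

  Therefore all of \<open>A\<close> lies on \<open>p\<close>, without two consecutive elements, and counting \<open>x\<close> as well gives
  \<open>|A| \<le> |J|\<close> (\<open>longest_path_spans\<close>). But deleting \<open>A\<close> leaves \<open>|J|\<close> isolated vertices, which
  contradicts toughness greater than one.

  The argument is carried out for a symmetric irreflexive relation on a finite set and then applied to
  the adjacency relation of the graph.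
\<close>

section \<open>Paths as vertex lists\<close>

locale adjacency =
  fixes V :: "'a set" and adj :: "'a \<Rightarrow> 'a \<Rightarrow> bool"
  assumes finite_V: "finite V"
    and adj_sym: "adj a b \<Longrightarrow> adj b a"
    and adj_irrefl: "\<not> adj a a"
    and adj_in_V: "adj a b \<Longrightarrow> a \<in> V"
begin

definition path :: "'a list \<Rightarrow> bool" where
  "path q \<longleftrightarrow> q \<noteq> [] \<and> distinct q \<and> set q \<subseteq> V \<and> successively adj q"

definition indep :: "'a set \<Rightarrow> bool" where
  "indep T \<longleftrightarrow> T \<subseteq> V \<and> (\<forall>s\<in>T. \<forall>t\<in>T. \<not> adj s t)"

definition no_cut_of_size_le :: "nat \<Rightarrow> bool" where
  "no_cut_of_size_le k \<longleftrightarrow> (\<forall>S X. S \<subseteq> V \<longrightarrow> card S \<le> k \<longrightarrow> X \<noteq> {} \<longrightarrow> X \<subset> V - S \<longrightarrow>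
     (\<exists>a\<in>X. \<exists>b\<in>V - S - X. adj a b))"

text \<open>
  This is freeness of an induced \<open>K\<^sub>2 \<union> kK\<^sub>1\<close> in the form of its use: every edge has
  a neighbour in every independent \<open>k\<close>-set. Were none of \<open>T\<close> adjacent to an end, then \<open>y\<close> and \<open>z\<close>
  would lie outside \<open>T\<close>, since each is adjacent to the other.
\<close>
definition edge_dominates :: "nat \<Rightarrow> bool" where
  "edge_dominates k \<longleftrightarrow> (\<forall>y z T. adj y z \<longrightarrow> indep T \<longrightarrow> card T = k \<longrightarrow> (\<exists>t\<in>T. adj y t \<or> adj z t))"

lemma indep_subset: "indep T \<Longrightarrow> S \<subseteq> T \<Longrightarrow> indep S"
  by (auto simp: indep_def)

lemma edge_dominatesD:
  assumes "edge_dominates k" "adj y z" "indep T" "k \<le> card T"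
  shows "\<exists>t\<in>T. adj y t \<or> adj z t"
proof -
  obtain S where "S \<subseteq> T" "card S = k"
    using assms(4) obtain_subset_with_card_n by metis
  then show ?thesis
    using assms indep_subset unfolding edge_dominates_def by blast
qed

lemma adj_commute: "adj a b \<longleftrightarrow> adj b a"
  using adj_sym by blast

lemma successively_adj_flip [simp]: "successively (\<lambda>x y. adj y x) q \<longleftrightarrow> successively adj q"
proof -
  have "(\<lambda>x y. adj y x) = adj"
    using adj_commute by (intro ext) blast
  then show ?thesis
    by (rule arg_cong[of _ _ "\<lambda>P. successively P q"])
qed

lemma path_within:
  assumes "(a, b) \<in> {(c, d). adj c d \<and> d \<in> U}\<^sup>*" "a \<in> U" "U \<subseteq> V"
  shows "\<exists>q. path q \<and> set q \<subseteq> U \<and> hd q = a \<and> last q = b"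
  using assms(1)
proof (induction rule: rtrancl_induct)
  case base
  then show ?case
    using assms by (intro exI[of _ "[a]"]) (auto simp: path_def)
next
  case (step c d)
  then obtain q where q: "path q" "set q \<subseteq> U" "hd q = a" "last q = c"
    by blast
  show ?case
  proof (cases "d \<in> set q")
    case True
    then obtain q1 q2 where "q = q1 @ d # q2"
      by (meson split_list)
    then show ?thesis
      using q by (intro exI[of _ "q1 @ [d]"])
        (auto simp: path_def successively_append_iff hd_append split: if_splits)
  next
    case False
    then show ?thesis
      using q step assms by (intro exI[of _ "q @ [d]"])
        (auto simp: path_def successively_append_iff)
  qed
qed

lemma path_between:
  assumes "no_cut_of_size_le k" "u \<in> V" "v \<in> V"
  shows "\<exists>q. path q \<and> hd q = u \<and> last q = v"
proof -
  define X where "X = {c \<in> V. (u, c) \<in> {(c, d). adj c d \<and> d \<in> V}\<^sup>*}"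
  have "v \<in> X"
  proof (rule ccontr)
    assume "v \<notin> X"
    moreover have "u \<in> X"
      using assms by (auto simp: X_def)
    ultimately have "X \<noteq> {}" "X \<subset> V - {}"
      using assms by (auto simp: X_def)
    then obtain a b where "a \<in> X" "b \<in> V - {} - X" "adj a b"
      using assms(1) unfolding no_cut_of_size_le_def by (metis card.empty empty_subsetI le0)
    then show False
      by (auto simp: X_def dest: rtrancl_into_rtrancl)
  qed
  then show ?thesis
    using path_within[of u v V] assms by (auto simp: X_def)
qed

lemma path_append_iff:
  assumes "X \<noteq> []" "Y \<noteq> []"
  shows "path (X @ Y) \<longleftrightarrow> path X \<and> path Y \<and> set X \<inter> set Y = {} \<and> adj (last X) (hd Y)"
  using assms by (auto simp: path_def successively_append_iff)

lemma path_Cons_iff: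
  "q \<noteq> [] \<Longrightarrow> path (x # q) \<longleftrightarrow> x \<in> V \<and> x \<notin> set q \<and> adj x (hd q) \<and> path q"
  by (auto simp: path_def successively_Cons)

lemma path_rev_iff: "path (rev q) \<longleftrightarrow> path q"
  by (simp add: path_def successively_rev)

lemma path_length_le: "path q \<Longrightarrow> length q \<le> card V"
  by (metis path_def card_mono distinct_card finite_V)

lemma longest_path_exists:
  assumes "path q"
  shows "\<exists>p. path p \<and> hd p = hd q \<and> last p = last q \<and>
    (\<forall>r. path r \<longrightarrow> hd r = hd q \<longrightarrow> last r = last q \<longrightarrow> length r \<le> length p)"
proof -
  let ?P = "\<lambda>p. path p \<and> hd p = hd q \<and> last p = last q"
  have "?P (arg_max length ?P) \<and> (\<forall>r. ?P r \<longrightarrow> length r \<le> length (arg_max length ?P))"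
    by (rule arg_max_nat_lemma[of ?P q length "Suc (card V)"])
       (use assms path_length_le in \<open>auto simp: less_Suc_eq_le\<close>)
  then show ?thesis
    by blast
qed

end

lemma split_after_index:
  assumes "Suc a < length l"
  obtains X Y where "l = X @ Y" "X \<noteq> []" "Y \<noteq> []" "length X = Suc a" "last X = l ! a" "hd Y = l ! Suc a"
proof
  show "l = take (Suc a) l @ drop (Suc a) l"
    by simp
qed (use assms in \<open>auto simp: hd_drop_conv_nth take_Suc_conv_app_nth\<close>)

lemma split_after_two_indices:
  assumes "a < b" "Suc b < length l"
  obtains X Y Z where "l = X @ Y @ Z" "X \<noteq> []" "Y \<noteq> []" "Z \<noteq> []" "length (X @ Y) = Suc b"
    "last X = l ! a" "hd Y = l ! Suc a" "last Y = l ! b" "hd Z = l ! Suc b"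
proof -
  obtain W Z where W: "l = W @ Z" "W \<noteq> []" "Z \<noteq> []" "length W = Suc b" "last W = l ! b" "hd Z = l ! Suc b"
    using split_after_index[OF assms(2)] .
  have "Suc a < length W"
    using W assms by simp
  then obtain X Y where "W = X @ Y" "X \<noteq> []" "Y \<noteq> []" "last X = W ! a" "hd Y = W ! Suc a"
    using split_after_index[of a W] by metis
  moreover have "W ! a = l ! a" "W ! Suc a = l ! Suc a"
    using W assms by (simp_all add: nth_append)
  ultimately show ?thesis
    using that[of X Y Z] W by simp
qed

lemma split_after_three_indices:
  assumes "a < b" "b < c" "Suc c < length l"
  obtains W X Y Z where "l = W @ X @ Y @ Z" "W \<noteq> []" "X \<noteq> []" "Y \<noteq> []" "Z \<noteq> []"
    "last W = l ! a" "hd X = l ! Suc a" "last X = l ! b" "hd Y = l ! Suc b"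
    "last Y = l ! c" "hd Z = l ! Suc c"
proof -
  obtain U Z where U: "l = U @ Z" "U \<noteq> []" "Z \<noteq> []" "length U = Suc c" "last U = l ! c" "hd Z = l ! Suc c"
    using split_after_index[OF assms(3)] .
  have "Suc b < length U"
    using U assms by simp
  with assms(1) obtain W X Y where "U = W @ X @ Y" "W \<noteq> []" "X \<noteq> []" "Y \<noteq> []" "last W = U ! a"
    "hd X = U ! Suc a" "last X = U ! b" "hd Y = U ! Suc b"
    by (rule split_after_two_indices)
  moreover have "U ! a = l ! a" "U ! Suc a = l ! Suc a" "U ! b = l ! b" "U ! Suc b = l ! Suc b"
    using U assms by (simp_all add: nth_append)
  ultimately show ?thesis
    using that[of W X Y Z] U by simp
qed

section \<open>Detours around a longest path\<close>

locale longest_path = adjacency V adj for V :: "'a set" and adj +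
  fixes p :: "'a list"
  assumes path_p: "path p"
    and longest: "path q \<Longrightarrow> hd q = hd p \<Longrightarrow> last q = last p \<Longrightarrow> length q \<le> length p"
begin

text \<open>
  An excursion from \<open>a\<close> to \<open>b\<close> through vertices off \<open>p\<close>. The list \<open>D\<close> is nonempty, so replacing
  an edge by a detour always lengthens a path. Working with detours instead of single vertices treats
  an isolated vertex off \<open>p\<close> and a larger component off \<open>p\<close> alike.
\<close>
definition detour :: "'a list \<Rightarrow> 'a \<Rightarrow> 'a \<Rightarrow> bool" where
  "detour D a b \<longleftrightarrow> path D \<and> set D \<inter> set p = {} \<and> adj a (hd D) \<and> adj (last D) b"

lemma detour_nonempty: "detour D a b \<Longrightarrow> D \<noteq> []"
  by (simp add: detour_def path_def)

lemma detour_singleton: "x \<in> V \<Longrightarrow> x \<notin> set p \<Longrightarrow> adj x a \<Longrightarrow> adj x b \<Longrightarrow> detour [x] a b"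
  using adj_sym by (auto simp: detour_def path_def)

lemma no_detour_along_edge:
  assumes "Suc a < length p" "detour D (p ! a) (p ! Suc a)"
  shows False
proof -
  obtain X Y where X: "p = X @ Y" "X \<noteq> []" "Y \<noteq> []" "last X = p ! a" "hd Y = p ! Suc a"
    using split_after_index[OF assms(1)] by metis
  have "path (X @ Y)"
    using X path_p by simp
  then have "path (X @ D @ Y)"
    using X assms(2) detour_nonempty[OF assms(2)] unfolding detour_def
    by (auto simp: path_append_iff path_rev_iff hd_rev last_rev)
  from longest[OF this] show False
    using X detour_nonempty[OF assms(2)] by simp
qed

text \<open>
  Otherwise the following path is longer: along \<open>p\<close> to position \<open>a\<close>, by the detour to position \<open>b\<close>,
  backwards along \<open>p\<close> to position \<open>a + 1\<close>, and across to position \<open>b + 1\<close>.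
\<close>
lemma detour_successors_nonadj:
  assumes "a < b" "Suc b < length p" "detour D (p ! a) (p ! b)"
  shows "\<not> adj (p ! Suc a) (p ! Suc b)"
proof
  assume "adj (p ! Suc a) (p ! Suc b)"
  obtain X Y Z where X: "p = X @ Y @ Z" "X \<noteq> []" "Y \<noteq> []" "Z \<noteq> []"
    "last X = p ! a" "hd Y = p ! Suc a" "last Y = p ! b" "hd Z = p ! Suc b"
    using split_after_two_indices[OF assms(1,2)] by metis
  have "path (X @ Y @ Z)"
    using X path_p by simp
  then have "path (X @ D @ rev Y @ Z)"
    using X assms(3) \<open>adj (p ! Suc a) (p ! Suc b)\<close> detour_nonempty[OF assms(3)] unfolding detour_def
    by (auto simp: path_append_iff path_rev_iff hd_rev last_rev)
  from longest[OF this] show False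
    using X detour_nonempty[OF assms(3)] by simp
qed

text \<open>
  The same rerouting, with \<open>y\<close> in place of the edge between the two successors.
\<close>
lemma detour_successors_no_common_neighbour:
  assumes "a < b" "Suc b < length p" "detour D (p ! a) (p ! b)" "y \<notin> set p" "y \<notin> set D"
  shows "\<not> (adj y (p ! Suc a) \<and> adj y (p ! Suc b))"
proof
  assume y: "adj y (p ! Suc a) \<and> adj y (p ! Suc b)"
  obtain X Y Z where X: "p = X @ Y @ Z" "X \<noteq> []" "Y \<noteq> []" "Z \<noteq> []"
    "last X = p ! a" "hd Y = p ! Suc a" "last Y = p ! b" "hd Z = p ! Suc b"
    using split_after_two_indices[OF assms(1,2)] by metis
  have "path (X @ Y @ Z)"
    using X path_p by simp
  then have "path (X @ D @ rev Y @ [y] @ Z)"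
    using X assms(3-5) y adj_sym adj_in_V detour_nonempty[OF assms(3)] unfolding detour_def
    by (auto simp: path_append_iff path_Cons_iff path_rev_iff hd_rev last_rev)
  from longest[OF this] show False
    using X detour_nonempty[OF assms(3)] by simp
qed

text \<open>
  The next three lemmas concern an edge of \<open>p\<close> from position \<open>t\<close> to \<open>t + 1\<close> and the successors of two
  positions \<open>a < b\<close> joined by a detour. If each end of the edge were adjacent to one of the two
  successors, matched as stated, then \<open>p\<close> could be cut at the edge and after \<open>a\<close> and \<open>b\<close> into four
  pieces and reassembled with the detour. Which matching is impossible depends on whether the edge
  comes after \<open>b\<close>, between \<open>a\<close> and \<open>b\<close>, or before \<open>a\<close>.
\<close>
lemma crossing_after:
  assumes "a < b" "b < t" "Suc t < length p" "detour D (p ! a) (p ! b)"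
  shows "\<not> (adj (p ! t) (p ! Suc a) \<and> adj (p ! Suc t) (p ! Suc b))"
proof
  assume y: "adj (p ! t) (p ! Suc a) \<and> adj (p ! Suc t) (p ! Suc b)"
  obtain W X Y Z where X: "p = W @ X @ Y @ Z" "W \<noteq> []" "X \<noteq> []" "Y \<noteq> []" "Z \<noteq> []"
    "last W = p ! a" "hd X = p ! Suc a" "last X = p ! b" "hd Y = p ! Suc b"
    "last Y = p ! t" "hd Z = p ! Suc t"
    using split_after_three_indices[OF assms(1-3)] by metis
  have "path (W @ X @ Y @ Z)"
    using X path_p by simp
  then have "path (W @ D @ rev X @ rev Y @ Z)"
    using X assms(4) y adj_sym detour_nonempty[OF assms(4)] unfolding detour_def
    by (auto simp: path_append_iff path_rev_iff hd_rev last_rev)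
  from longest[OF this] show False
    using X detour_nonempty[OF assms(4)] by simp
qed

lemma crossing_between:
  assumes "a < t" "t < b" "Suc b < length p" "detour D (p ! a) (p ! b)"
  shows "\<not> (adj (p ! t) (p ! Suc b) \<and> adj (p ! Suc t) (p ! Suc a))"
proof
  assume y: "adj (p ! t) (p ! Suc b) \<and> adj (p ! Suc t) (p ! Suc a)"
  obtain W X Y Z where X: "p = W @ X @ Y @ Z" "W \<noteq> []" "X \<noteq> []" "Y \<noteq> []" "Z \<noteq> []"
    "last W = p ! a" "hd X = p ! Suc a" "last X = p ! t" "hd Y = p ! Suc t"
    "last Y = p ! b" "hd Z = p ! Suc b"
    using split_after_three_indices[OF assms(1-3)] by metis
  have "path (W @ X @ Y @ Z)"
    using X path_p by simp
  then have "path (W @ D @ rev Y @ X @ Z)"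
    using X assms(4) y adj_sym detour_nonempty[OF assms(4)] unfolding detour_def
    by (auto simp: path_append_iff path_rev_iff hd_rev last_rev)
  from longest[OF this] show False
    using X detour_nonempty[OF assms(4)] by simp
qed

lemma crossing_before:
  assumes "t < a" "a < b" "Suc b < length p" "detour D (p ! b) (p ! a)"
  shows "\<not> (adj (p ! t) (p ! Suc a) \<and> adj (p ! Suc t) (p ! Suc b))"
proof
  assume y: "adj (p ! t) (p ! Suc a) \<and> adj (p ! Suc t) (p ! Suc b)"
  obtain W X Y Z where X: "p = W @ X @ Y @ Z" "W \<noteq> []" "X \<noteq> []" "Y \<noteq> []" "Z \<noteq> []"
    "last W = p ! t" "hd X = p ! Suc t" "last X = p ! a" "hd Y = p ! Suc a"
    "last Y = p ! b" "hd Z = p ! Suc b"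
    using split_after_three_indices[OF assms(1-3)] by metis
  have "path (W @ X @ Y @ Z)"
    using X path_p by simp
  then have "path (W @ Y @ D @ rev X @ Z)"
    using X assms(4) y adj_sym detour_nonempty[OF assms(4)] unfolding detour_def
    by (auto simp: path_append_iff path_rev_iff hd_rev last_rev)
  from longest[OF this] show False
    using X detour_nonempty[OF assms(4)] by simp
qed

lemma nth_inj: "i < length p \<Longrightarrow> j < length p \<Longrightarrow> p ! i = p ! j \<longleftrightarrow> i = j"
  using path_p nth_eq_iff_index_eq unfolding path_def by blast

lemma inj_on_successor: "(\<And>i. i \<in> K \<Longrightarrow> Suc i < length p) \<Longrightarrow> inj_on (\<lambda>i. p ! Suc i) K"
  by (metis (mono_tags, lifting) Suc_inject inj_onI nth_inj)

section \<open>The vertices off a longest path are isolated\<close>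

text \<open>
  Any two positions of \<open>p\<close> with neighbours in the component \<open>C\<close> of \<open>x\<close> off \<open>p\<close> are joined by a
  detour. So these positions are never consecutive, and the vertices that follow them are pairwise
  non-adjacent and not adjacent to \<open>C\<close>. Since \<open>C\<close> cannot be cut off by \<open>k\<close> vertices, there are at least
  \<open>k\<close> such followers, and neither end of the edge \<open>xy\<close> is adjacent to any of them.
\<close>
lemma off_path_nonadj:
  assumes conn: "no_cut_of_size_le k" and dom: "edge_dominates k" and len: "2 \<le> length p"
    and x: "x \<in> V - set p" and y: "y \<in> V - set p"
  shows "\<not> adj x y"
proof
  assume "adj x y"
  define R where "R = {(c, d). adj c d \<and> d \<in> V - set p}"
  define C where "C = {c \<in> V - set p. (x, c) \<in> R\<^sup>*}"
  define N where "N = {i. i < length p \<and> (\<exists>c\<in>C. adj c (p ! i))}"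
  have xC: "x \<in> C"
    using x by (auto simp: C_def)
  have yC: "y \<in> C"
    using y \<open>adj x y\<close> by (auto simp: C_def R_def)
  have reach_back: "(c, x) \<in> R\<^sup>*" if "(x, c) \<in> R\<^sup>*" for c
    using that
  proof (induction rule: rtrancl_induct)
    case (step c d)
    have "c \<in> V - set p"
      using step.hyps(1) x by (cases rule: rtranclE) (auto simp: R_def)
    then have "(d, c) \<in> R"
      using step.hyps(2) adj_sym by (auto simp: R_def)
    then show ?case
      using step.IH by (rule converse_rtrancl_into_rtrancl)
  qed simp
  have det: "\<exists>D. detour D (p ! i) (p ! j)" if "i \<in> N" "j \<in> N" for i j
  proof -
    from that obtain c d where c: "c \<in> C" "adj c (p ! i)" and d: "d \<in> C" "adj d (p ! j)"
      by (auto simp: N_def)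
    have "(c, d) \<in> R\<^sup>*"
      using c d reach_back[of c] by (auto simp: C_def dest: rtrancl_trans)
    then obtain D where "path D" "set D \<subseteq> V - set p" "hd D = c" "last D = d"
      using path_within[of c d "V - set p"] c by (auto simp: C_def R_def)
    then show ?thesis
      using c d adj_sym by (intro exI[of _ D]) (auto simp: detour_def)
  qed
  have no_consec: "\<not> (i \<in> N \<and> Suc i \<in> N)" if "Suc i < length p" for i
    using det no_detour_along_edge[OF that] by blast
  have finN: "finite N"
    by (simp add: N_def)
  have "k < card N"
  proof (rule ccontr)
    assume "\<not> k < card N"
    define S where "S = (!) p ` N"
    have S: "S \<subseteq> V" "card S \<le> k" "S \<subseteq> set p"
      using path_p card_image_le[OF finN, of "(!) p"] \<open>\<not> k < card N\<close>
      by (auto simp: S_def N_def path_def)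
    \<comment> \<open>One of the first two vertices of \<open>p\<close> lies outside \<open>S\<close>, so \<open>S\<close> separates it from \<open>C\<close>.\<close>
    obtain i where "i < length p" "i \<notin> N"
      using no_consec[of 0] len by (metis Suc_1 Suc_le_lessD less_2_cases_iff less_le_trans one_less_numeral_iff pos2)
    then have "p ! i \<notin> S"
      by (auto simp: S_def N_def nth_inj)
    moreover have "p ! i \<in> V" "p ! i \<notin> C"
      using path_p \<open>i < length p\<close> by (auto simp: C_def path_def)
    ultimately have "C \<subset> V - S"
      using S by (auto simp: C_def)
    then obtain a b where ab: "a \<in> C" "b \<in> V - S - C" "adj a b"
      using conn S xC unfolding no_cut_of_size_le_def by (metis empty_iff)
    show False
    proof (cases "b \<in> set p")
      case True
      then show ?thesis
        using ab by (auto simp: S_def N_def in_set_conv_nth)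
    next
      case False
      then have "(a, b) \<in> R"
        using ab by (auto simp: R_def)
      then show ?thesis
        using ab False by (auto simp: C_def dest: rtrancl_into_rtrancl)
    qed
  qed
  \<comment> \<open>The last vertex of \<open>p\<close> has no successor; hence the strict inequality above.\<close>
  define K where "K = N - {length p - 1}"
  have K: "Suc i < length p" "i \<in> N" if "i \<in> K" for i
    using that by (auto simp: K_def N_def)
  define T where "T = (\<lambda>i. p ! Suc i) ` K"
  have "card T = card K"
    unfolding T_def using K by (intro card_image inj_on_successor)
  moreover have "k \<le> card K"
    using \<open>k < card N\<close> finN by (auto simp: K_def card_Diff_singleton_if)
  ultimately have "k \<le> card T"
    by simp
  moreover have "indep T"
  proof -
    have lt: "\<not> adj (p ! Suc i) (p ! Suc j)" if "i \<in> K" "j \<in> K" "i < j" for i j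
      using det[of i j] detour_successors_nonadj[of i j] K that by blast
    then have "\<not> adj (p ! Suc i) (p ! Suc j)" if "i \<in> K" "j \<in> K" for i j
      using that adj_sym adj_irrefl by (metis linorder_neqE_nat)
    then show ?thesis
      using K path_p by (auto simp: indep_def T_def path_def)
  qed
  moreover have "\<not> adj c t" if "c \<in> C" "t \<in> T" for c t
  proof
    assume "adj c t"
    then obtain i where i: "i \<in> K" "adj c (p ! Suc i)"
      using \<open>t \<in> T\<close> by (auto simp: T_def)
    then have "Suc i \<in> N"
      using K[OF i(1)] that(1) by (auto simp: N_def)
    then show False
      using no_consec K[OF i(1)] by blast
  qed
  ultimately show False
    using edge_dominatesD[OF dom \<open>adj x y\<close>] xC yC by blast
qed

end

section \<open>Counting along the path\<close>

text \<open>
  Let \<open>a\<close> be the first element of \<open>K \<inter> N\<close> in the order given by \<open>f\<close>. What comes before \<open>a\<close> is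
  not in \<open>N\<close>, what comes after \<open>a\<close> is not in \<open>M\<close>, and the final \<open>1\<close> accounts for \<open>a\<close> itself.
\<close>
lemma card_le_of_no_ordered_pair:
  fixes f :: "'b \<Rightarrow> nat"
  assumes "finite K" "inj_on f K"
    and no_pair: "\<And>a b. a \<in> K \<Longrightarrow> b \<in> K \<Longrightarrow> a \<in> N \<Longrightarrow> b \<in> M \<Longrightarrow> \<not> f a < f b"
  shows "card K \<le> card (K - N) + card (K - M) + 1"
proof (cases "K \<inter> N = {}")
  case True
  then have "K - N = K"
    by blast
  then show ?thesis
    by simp
next
  case False
  then obtain a where a: "a \<in> K" "a \<in> N" and min: "\<And>b. b \<in> K \<inter> N \<Longrightarrow> f a \<le> f b"
    using arg_min_nat_lemma[of "\<lambda>b. b \<in> K \<inter> N" _ f] by (metis Int_iff ex_in_conv)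
  have "b \<in> (K - N) \<union> (K - M) \<union> {a}" if "b \<in> K" for b
    using that a min[of b] no_pair[of a b] inj_onD[OF assms(2), of a b] by fastforce
  then have "card K \<le> card ((K - N) \<union> (K - M) \<union> {a})"
    using assms(1) by (intro card_mono) auto
  also have "\<dots> \<le> card (K - N) + card (K - M) + card {a}"
    by (meson add_le_mono card_Un_le le_trans order_refl)
  finally show ?thesis
    by simp
qed

lemma filter_le_if_no_two_consecutive:
  assumes "successively (\<lambda>x y. \<not> (P x \<and> P y)) l"
  shows "length (filter P l) \<le> Suc (length (filter (\<lambda>x. \<not> P x) l))"
proof -
  have "length (filter P l) \<le> length (filter (\<lambda>x. \<not> P x) l) + (if l \<noteq> [] \<and> P (hd l) then 1 else 0)"
    using assms by (induction l rule: induct_list012) (auto split: if_splits)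
  then show ?thesis
    by (simp split: if_splits)
qed

context longest_path
begin

definition nbr_positions :: "'a \<Rightarrow> nat set" where
  "nbr_positions x = {i. Suc i < length p \<and> adj x (p ! i)}"

definition successors :: "'a \<Rightarrow> 'a set" where
  "successors x = (\<lambda>i. p ! Suc i) ` nbr_positions x"

lemma finite_nbr_positions [simp]: "finite (nbr_positions x)"
  by (auto simp: nbr_positions_def intro: finite_subset[of _ "{..<length p}"])

lemma inj_on_successors: "inj_on (\<lambda>i. p ! Suc i) (nbr_positions x)"
  by (intro inj_on_successor) (auto simp: nbr_positions_def)

lemma successors_subset: "successors x \<subseteq> set p"
  by (auto simp: successors_def nbr_positions_def)

lemma finite_successors [simp]: "finite (successors x)"
  by (simp add: successors_def)

lemma card_successors: "card (successors x) = card (nbr_positions x)"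
  unfolding successors_def by (intro card_image inj_on_successors)

lemma card_filter_successors:
  "card {i \<in> nbr_positions x. P (p ! Suc i)} = card {s \<in> successors x. P s}"
proof -
  have "{s \<in> successors x. P s} = (\<lambda>i. p ! Suc i) ` {i \<in> nbr_positions x. P (p ! Suc i)}"
    by (auto simp: successors_def)
  then show ?thesis
    using inj_on_subset[OF inj_on_successors] by (metis (no_types, lifting) card_image mem_Collect_eq subsetI)
qed

lemma detour_via:
  assumes "x \<in> V - set p" "i \<in> nbr_positions x" "j \<in> nbr_positions x"
  shows "detour [x] (p ! i) (p ! j)"
  using assms by (intro detour_singleton) (auto simp: nbr_positions_def)

lemma no_two_consecutive_nbrs:
  assumes "x \<in> V - set p" "Suc i < length p" "adj x (p ! i)"
  shows "\<not> adj x (p ! Suc i)"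
  using no_detour_along_edge[OF assms(2) detour_singleton] assms by blast

lemma indep_insert_successors:
  assumes x: "x \<in> V - set p"
  shows "indep (insert x (successors x))"
proof -
  have "\<not> adj x s" if "s \<in> successors x" for s
    using that no_two_consecutive_nbrs[OF x] by (auto simp: successors_def nbr_positions_def)
  moreover have lt: "\<not> adj (p ! Suc i) (p ! Suc j)"
    if "i \<in> nbr_positions x" "j \<in> nbr_positions x" "i < j" for i j
    using detour_successors_nonadj[OF that(3) _ detour_via[OF x that(1,2)]] that
    by (auto simp: nbr_positions_def)
  moreover have "\<not> adj s t" if "s \<in> successors x" "t \<in> successors x" for s t
    using that lt adj_sym adj_irrefl unfolding successors_def by (auto) (metis linorder_neqE_nat)
  moreover have "insert x (successors x) \<subseteq> V"
    using x successors_subset[of x] path_p by (auto simp: path_def)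
  ultimately show ?thesis
    using adj_sym adj_irrefl unfolding indep_def by blast
qed

lemma at_most_one_successor_nbr:
  assumes x: "x \<in> V - set p" and y: "y \<notin> set p" "y \<noteq> x"
  shows "card {s \<in> successors x. adj y s} \<le> 1"
proof -
  have "\<not> (adj y (p ! Suc i) \<and> adj y (p ! Suc j))"
    if "i \<in> nbr_positions x" "j \<in> nbr_positions x" "i < j" for i j
    using detour_successors_no_common_neighbour[OF that(3) _ detour_via[OF x that(1,2)], of y] that y
    by (auto simp: nbr_positions_def)
  then have "i = j" if "i \<in> nbr_positions x" "j \<in> nbr_positions x" "adj y (p ! Suc i)" "adj y (p ! Suc j)" for i j
    using that by (metis linorder_neqE_nat)
  then have "s = t" if "s \<in> successors x" "t \<in> successors x" "adj y s" "adj y t" for s t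
    using that by (auto simp: successors_def)
  then show ?thesis
    by (auto simp: card_le_Suc0_iff_eq)
qed

text \<open>
  List the successors cyclically, beginning after position \<open>t\<close>. The three crossing lemmas say
  precisely that in this order no neighbour of \<open>p ! t\<close> precedes a neighbour of \<open>p ! Suc t\<close>.
\<close>
lemma card_successors_le_missed:
  assumes x: "x \<in> V - set p" and t: "Suc t < length p" "\<not> adj x (p ! t)"
  shows "card (successors x) \<le>
    card {s \<in> successors x. \<not> adj (p ! t) s} + card {s \<in> successors x. \<not> adj (p ! Suc t) s} + 1"
proof -
  let ?K = "nbr_positions x"
  \<comment> \<open>The cyclic order, as a numbering of the positions.\<close>
  define f where "f i = (if t < i then i else i + length p)" for i
  let ?N = "{i. adj (p ! t) (p ! Suc i)}" and ?M = "{i. adj (p ! Suc t) (p ! Suc i)}"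
  have K: "Suc i < length p" "i \<noteq> t" if "i \<in> ?K" for i
    using that t by (auto simp: nbr_positions_def)
  have "card ?K \<le> card (?K - ?N) + card (?K - ?M) + 1"
  proof (rule card_le_of_no_ordered_pair)
    show "inj_on f ?K"
      using K by (force simp: inj_on_def f_def split: if_splits)
  next
    fix a b
    assume ab: "a \<in> ?K" "b \<in> ?K" "a \<in> ?N" "b \<in> ?M"
    show "\<not> f a < f b"
    proof
      assume "f a < f b"
      then consider "t < a" "a < b" | "b < t" "t < a" | "a < b" "b < t"
        using K[OF ab(1)] K[OF ab(2)] by (auto simp: f_def split: if_splits)
      then show False
      proof cases
        case 1
        then show ?thesis
          using crossing_before[OF 1 _ detour_via[OF x ab(2,1)]] K ab by auto
      next
        case 2
        then show ?thesis
          using crossing_between[OF 2 _ detour_via[OF x ab(2,1)]] K ab by auto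
      next
        case 3
        then show ?thesis
          using crossing_after[OF 3 t(1) detour_via[OF x ab(1,2)]] ab by auto
      qed
    qed
  qed simp
  moreover have "?K - ?N = {i \<in> ?K. \<not> adj (p ! t) (p ! Suc i)}"
    "?K - ?M = {i \<in> ?K. \<not> adj (p ! Suc t) (p ! Suc i)}"
    by auto
  ultimately show ?thesis
    using card_filter_successors[of x "\<lambda>s. \<not> adj (p ! t) s"]
      card_filter_successors[of x "\<lambda>s. \<not> adj (p ! Suc t) s"]
    by (simp add: card_successors)
qed

section \<open>A longest path is a Hamilton path\<close>

text \<open>
  With \<open>I\<close>, \<open>A\<close> and \<open>J\<close> as in the introduction, the vertices of \<open>p\<close> in \<open>A\<close> outnumber those in \<open>J\<close> by
  at most one, and the vertex \<open>x\<close> off \<open>p\<close>, which is in \<open>J\<close>, makes up for it.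
\<close>
theorem longest_path_spans:
  assumes conn: "no_cut_of_size_le k" and dom: "edge_dominates k" and len: "2 \<le> length p"
    and k: "1 \<le> k"
    and tough: "\<And>J. indep J \<Longrightarrow> 2 \<le> card J \<Longrightarrow> card J < card (V - J)"
    and deg: "\<And>x. x \<in> V \<Longrightarrow> 2 * k \<le> card {y. adj x y}"
  shows "set p = V"
proof (rule ccontr)
  assume "set p \<noteq> V"
  then obtain x where x: "x \<in> V - set p"
    using path_p by (auto simp: path_def)
  define I where "I = insert x (successors x)"
  have finI: "finite I"
    by (simp add: I_def)
  have xS: "x \<notin> successors x"
    using x successors_subset by blast
  have I: "indep I"
    unfolding I_def by (rule indep_insert_successors[OF x])
  \<comment> \<open>Only the last vertex of \<open>p\<close> can be a neighbour of \<open>x\<close> without a successor.\<close>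
  have "card {y. adj x y} \<le> card (insert (last p) ((!) p ` nbr_positions x))"
  proof (intro card_mono subsetI)
    fix y
    assume "y \<in> {y. adj x y}"
    then have y: "adj x y" "y \<in> V"
      using adj_sym adj_in_V by blast+
    then have "y \<in> set p"
      using off_path_nonadj[OF conn dom len x] by blast
    then obtain i where i: "i < length p" "y = p ! i"
      by (auto simp: in_set_conv_nth)
    show "y \<in> insert (last p) ((!) p ` nbr_positions x)"
    proof (cases "Suc i < length p")
      case False
      then have "i = length p - 1"
        using i by simp
      then show ?thesis
        using i by (simp add: last_conv_nth flip: length_greater_0_conv)
    qed (use i y in \<open>auto simp: nbr_positions_def\<close>)
  qed simp
  also have "\<dots> \<le> Suc (card (successors x))"
    using card_image_le[of "nbr_positions x" "(!) p"] by (simp add: card_insert_if card_successors)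
  finally have cardS: "2 * k \<le> Suc (card (successors x))"
    using deg[of x] x by simp
  have cardI: "card I = Suc (card (successors x))"
    using xS by (simp add: I_def)
  define A where "A = {a \<in> V. \<exists>s\<in>I. adj a s}"
  define J where "J = V - A"
  have IJ: "I \<subseteq> J"
    using I by (auto simp: indep_def J_def A_def)
  have J: "indep J"
  proof -
    have "\<not> adj y z" if "y \<in> J" "z \<in> J" for y z
      using edge_dominatesD[OF dom _ I, of y z] that cardI cardS by (auto simp: J_def A_def)
    then show ?thesis
      by (auto simp: indep_def J_def)
  qed
  have missed: "card {s \<in> I. \<not> adj a s} < k" if "a \<in> A" for a
  proof (rule ccontr)
    assume "\<not> card {s \<in> I. \<not> adj a s} < k"
    moreover obtain y where "y \<in> I" "adj a y"
      using \<open>a \<in> A\<close> by (auto simp: A_def)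
    moreover have "indep {s \<in> I. \<not> adj a s}"
      using I indep_subset by auto
    ultimately obtain s where "s \<in> I" "adj y s"
      using edge_dominatesD[OF dom, of a y "{s \<in> I. \<not> adj a s}"] by auto
    then show False
      using I \<open>y \<in> I\<close> by (auto simp: indep_def)
  qed
  have off: "y \<notin> A" if y: "y \<notin> set p" for y
  proof
    assume "y \<in> A"
    then have "y \<noteq> x"
      using IJ by (auto simp: J_def I_def)
    have nadj: "\<not> adj y x"
      using off_path_nonadj[OF conn dom len _ x] y \<open>y \<in> A\<close> by (auto simp: A_def)
    then have "I = {s \<in> successors x. adj y s} \<union> {s \<in> I. \<not> adj y s}"
      by (auto simp: I_def)
    then have "card I \<le> card {s \<in> successors x. adj y s} + card {s \<in> I. \<not> adj y s}"
      by (metis card_Un_le)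
    then show False
      using at_most_one_successor_nbr[OF x y \<open>y \<noteq> x\<close>] missed[OF \<open>y \<in> A\<close>] cardI cardS k by linarith
  qed
  have consec: "\<not> (p ! t \<in> A \<and> p ! Suc t \<in> A)" if t: "Suc t < length p" for t
  proof
    assume A: "p ! t \<in> A \<and> p ! Suc t \<in> A"
    have nadj: "\<not> adj x (p ! t)"
    proof
      assume "adj x (p ! t)"
      then have "p ! Suc t \<in> I"
        using t by (auto simp: I_def successors_def nbr_positions_def)
      then show False
        using A IJ by (auto simp: J_def)
    qed
    \<comment> \<open>One of the fewer than \<open>k\<close> non-neighbours of the first vertex is \<open>x\<close>, which leaves at most
      \<open>k - 2\<close> successors; the second vertex may be adjacent to \<open>x\<close>. In total at most \<open>(k - 2) + (k - 1) + 1\<close>, less than \<open>2k - 1\<close>.\<close>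
    have "{s \<in> I. \<not> adj (p ! t) s} = insert x {s \<in> successors x. \<not> adj (p ! t) s}"
      using nadj adj_sym by (auto simp: I_def)
    then have "Suc (card {s \<in> successors x. \<not> adj (p ! t) s}) < k"
      using missed[of "p ! t"] A xS by simp
    moreover have "card {s \<in> successors x. \<not> adj (p ! Suc t) s} \<le> card {s \<in> I. \<not> adj (p ! Suc t) s}"
      using finI by (intro card_mono) (auto simp: I_def)
    then have "card {s \<in> successors x. \<not> adj (p ! Suc t) s} < k"
      using missed[of "p ! Suc t"] A by simp
    ultimately show False
      using card_successors_le_missed[OF x t nadj] cardS by linarith
  qed
  have dp: "distinct p"
    using path_p by (simp add: path_def)
  have "card A \<le> card (set (filter (\<lambda>a. a \<in> A) p))"
    using off by (intro card_mono) auto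
  also have "\<dots> = length (filter (\<lambda>a. a \<in> A) p)"
    using dp by (intro distinct_card distinct_filter)
  also have "\<dots> \<le> Suc (length (filter (\<lambda>a. a \<notin> A) p))"
    using consec by (intro filter_le_if_no_two_consecutive) (simp add: successively_conv_nth)
  also have "length (filter (\<lambda>a. a \<notin> A) p) = card (set (filter (\<lambda>a. a \<notin> A) p))"
    using dp by (intro distinct_card[symmetric] distinct_filter)
  also have "Suc \<dots> = card (insert x (set (filter (\<lambda>a. a \<notin> A) p)))"
    using x by simp
  also have "\<dots> \<le> card J"
    using x off path_p finite_V by (intro card_mono) (auto simp: J_def path_def)
  finally have "card A \<le> card J" .
  moreover have "V - J = A"
    by (auto simp: J_def A_def)
  moreover have "card I \<le> card J"
    using IJ finite_V by (intro card_mono) (auto simp: J_def)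
  ultimately show False
    using tough[OF J] cardI cardS k by simp
qed

end

section \<open>Adjacency in a graph\<close>

lemma (in graph) adjacency_dominates: "adjacency (verts G) (dominates G)"
proof
  show "finite (verts G)"
    by simp
  show "(b, a) \<in> arcs_ends G" if "(a, b) \<in> arcs_ends G" for a b
    using that by (rule graph_symmetric)
  show "(a, a) \<notin> arcs_ends G" for a
    using adj_not_same by blast
  show "a \<in> verts G" if "(a, b) \<in> arcs_ends G" for a b
    using that by (rule adj_in_verts)
qed

lemma successively_dominates_iff:
  "successively (dominates G) p \<longleftrightarrow> set (vwalk_arcs p) \<subseteq> arcs_ends G"
  by (induction p rule: vwalk_arcs.induct) auto

context graph
begin

interpretation simple: adjacency "verts G" "dominates G"
  by (rule adjacency_dominates)

lemma path_iff_vpath: "simple.path p \<longleftrightarrow> vpath p G"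
  by (auto simp: simple.path_def vpath_def vwalk_def successively_dominates_iff)

lemma no_cut_if_m_connected:
  assumes "m_connected (k + 1) G"
  shows "simple.no_cut_of_size_le k"
  unfolding simple.no_cut_of_size_le_def
proof (intro allI impI)
  fix S X
  assume S: "S \<subseteq> verts G" "card S \<le> k" and X: "X \<noteq> {}" "X \<subset> verts G - S"
  let ?H = "delete_verts G S"
  from X obtain a b where a: "a \<in> X" and b: "b \<in> verts G - S - X"
    by blast
  have "S \<subset> verts G"
    using S X by blast
  then have "Digraph_Component.connected ?H"
    using assms S by (simp add: m_connected_def)
  moreover have "verts ?H = verts G - S"
    by (simp add: delete_verts_def)
  ultimately have reach: "a \<rightarrow>\<^sup>*\<^bsub>with_proj (mk_symmetric ?H)\<^esub> b"
    using a b X unfolding connected_def strongly_connected_def by auto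
  have step_in_G: "d \<in> verts G - S \<and> (c, d) \<in> arcs_ends G"
    if arc: "(c, d) \<in> arcs_ends (with_proj (mk_symmetric ?H))" for c d
  proof -
    obtain e where e: "e \<in> arcs G" "tail G e \<notin> S" "head G e \<notin> S"
      and cd: "(c, d) = (tail G e, head G e) \<or> (c, d) = (head G e, tail G e)"
      using arc by (auto simp: parcs_mk_symmetric delete_verts_def induce_subgraph_def)
    have "(tail G e, head G e) \<in> arcs_ends G"
      using e by (auto simp: arcs_ends_conv)
    then show ?thesis
      using e cd simple.adj_sym by auto
  qed
  show "\<exists>a\<in>X. \<exists>b\<in>verts G - S - X. a \<rightarrow>\<^bsub>G\<^esub> b"
  proof (rule ccontr)
    assume closed: "\<not> ?thesis"
    have "b \<in> X"
      using rtrancl_on_rtranclI[OF reach[unfolded reachable_def]]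
    proof (induction rule: rtrancl_induct)
      case (step c d)
      then show ?case
        using closed step_in_G by blast
    qed (rule a)
    then show False
      using b by blast
  qed
qed

lemma min_degree_le_card_nbrs:
  assumes "x \<in> verts G"
  shows "min_degree G \<le> card {y. x \<rightarrow>\<^bsub>G\<^esub> y}"
proof -
  have "inj_on (head G) (out_arcs G x)"
    by (auto simp: inj_on_def arc_to_ends_def intro: no_multi_arcs)
  then have "out_degree G x = card (head G ` out_arcs G x)"
    by (simp add: out_degree_def card_image)
  also have "head G ` out_arcs G x = {y. x \<rightarrow>\<^bsub>G\<^esub> y}"
    by (auto simp: arcs_ends_conv image_iff)
  finally show ?thesis
    using assms unfolding min_degree_def by (metis Min_le finite_imageI finite_verts imageI)
qed

lemma edge_dominates_if_induced_free:
  assumes "induced_free (with_proj (K2_union_kK1 k)) G"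
  shows "simple.edge_dominates k"
  unfolding simple.edge_dominates_def
proof (intro allI impI, rule ccontr)
  fix y z T
  assume yz: "y \<rightarrow>\<^bsub>G\<^esub> z" and T: "simple.indep T" "card T = k"
    and nadj: "\<not> (\<exists>t\<in>T. y \<rightarrow>\<^bsub>G\<^esub> t \<or> z \<rightarrow>\<^bsub>G\<^esub> t)"
  have yzT: "y \<noteq> z" "y \<notin> T" "z \<notin> T" "y \<in> verts G" "z \<in> verts G" "T \<subseteq> verts G"
    using yz nadj T simple.adj_sym simple.adj_in_V simple.adj_irrefl by (auto simp: simple.indep_def)
  have "finite T"
    using yzT(6) by (rule finite_subset) simp
  then obtain h where "bij_betw h T {2..<k + 2}"
    using T by (metis card_atLeastLessThan diff_add_inverse2 finite_atLeastLessThan finite_same_card_bij)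
  then have h: "h ` T = {2..<k + 2}" "inj_on h T"
    by (auto simp: bij_betw_def)
  define f where "f v = (if v = y then 0 else if v = z then 1 else h v)" for v
  have f: "f y = 0" "f z = 1" "\<And>t. t \<in> T \<Longrightarrow> f t = h t"
    using yzT by (auto simp: f_def)
  have fT: "f ` T = {2..<k + 2}" "inj_on f T"
    using h f by (auto simp: image_def inj_on_def)
  let ?X = "{y, z} \<union> T"
  let ?H = "G \<restriction> ?X"
  have H: "induced_subgraph ?H G"
    using yzT by (intro induced_induce) auto
  then have wfH: "wf_digraph ?H"
    by auto
  define iso where "iso = \<lparr>iso_verts = f, iso_arcs = (\<lambda>e. (f (tail G e), f (head G e))), iso_head = snd, iso_tail = fst\<rparr>"
  have injf: "inj_on f ?X"
  proof -
    have "inj_on f {y, z}"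
      using f(1,2) by (auto simp: inj_on_def)
    moreover have "f ` {y, z} = {0, 1}"
      using f(1,2) by simp
    then have "f ` {y, z} \<inter> f ` T = {}"
      unfolding fT(1) by simp
    then have "f ` ({y, z} - T) \<inter> f ` (T - {y, z}) = {}"
      by blast
    ultimately show ?thesis
      using fT(2) unfolding inj_on_Un by simp
  qed
  have ends: "(\<lambda>e. (tail G e, head G e)) ` arcs ?H = {(y, z), (z, y)}"
  proof -
    have "(\<lambda>e. (tail G e, head G e)) ` arcs ?H = arcs_ends G \<inter> ?X \<times> ?X"
      by (auto simp: arcs_ends_conv induce_subgraph_def image_iff)
    also have "\<dots> = {(y, z), (z, y)}"
      using yz T nadj simple.adj_sym simple.adj_irrefl by (auto simp: simple.indep_def)
    finally show ?thesis .
  qed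
  have "pre_digraph.digraph_isomorphism ?H iso"
    unfolding pre_digraph.digraph_isomorphism_def
  proof (intro conjI ballI wfH)
    show "inj_on (iso_arcs iso) (arcs ?H)"
    proof (rule inj_onI)
      fix e e'
      assume e: "e \<in> arcs ?H" "e' \<in> arcs ?H" "iso_arcs iso e = iso_arcs iso e'"
      then have "tail G e = tail G e'" "head G e = head G e'"
        using inj_onD[OF injf] by (auto simp: iso_def)
      then show "e = e'"
        using e no_multi_arcs by (auto simp: arc_to_ends_def)
    qed
  qed (use injf in \<open>auto simp: iso_def\<close>)
  moreover have "with_proj (K2_union_kK1 k) = app_iso iso ?H"
  proof (rule pre_digraph.equality)
    have "f ` ?X = {0, 1} \<union> {2..<k + 2}"
      using f fT by auto
    also have "\<dots> = {..<k + 2}"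
      by auto
    finally show "verts (with_proj (K2_union_kK1 k)) = verts (app_iso iso ?H)"
      by (simp add: K2_union_kK1_def iso_def)
    have "iso_arcs iso ` arcs ?H = (\<lambda>(a, b). (f a, f b)) ` (\<lambda>e. (tail G e, head G e)) ` arcs ?H"
      by (simp add: iso_def image_image)
    also have "\<dots> = {(0, 1), (1, 0)}"
      unfolding ends using f by auto
    finally show "arcs (with_proj (K2_union_kK1 k)) = arcs (app_iso iso ?H)"
      by (simp add: K2_union_kK1_def)
  qed (simp_all add: iso_def)
  ultimately have "digraph_iso ?H (with_proj (K2_union_kK1 k))"
    unfolding digraph_iso_def by blast
  then show False
    using assms H unfolding induced_free_def by blast
qed

end

lemma reachable_without_arcs:
  assumes "arcs H = {}" "u \<rightarrow>\<^sup>*\<^bsub>H\<^esub> v"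
  shows "u = v"
  using rtrancl_on_rtranclI[OF assms(2)[unfolded reachable_def]] assms(1) by (simp add: arcs_ends_def)

text \<open>
  The components are the one-vertex subgraphs: a strongly connected graph without arcs has only one
  vertex.
\<close>
lemma num_components_without_arcs:
  assumes "wf_digraph H" "arcs H = {}"
  shows "num_components H = card (verts H)"
proof -
  interpret H: wf_digraph H by fact
  let ?single = "\<lambda>v. H \<restriction> {v}"
  have singleton: "\<exists>v\<in>verts H. verts c = {v}" if c: "induced_subgraph c H" "strongly_connected c" for c
  proof -
    have "arcs c = {}" "verts c \<subseteq> verts H"
      using c assms(2) by auto
    moreover obtain v where "v \<in> verts c"
      using c(2) by (auto simp: strongly_connected_def)
    moreover have "w = v" if "w \<in> verts c" for w
      using reachable_without_arcs[OF \<open>arcs c = {}\<close>, of w v] c(2) that \<open>v \<in> verts c\<close>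
      by (simp add: strongly_connected_def)
    ultimately show ?thesis
      by blast
  qed
  have "H.sccs = ?single ` verts H"
  proof (intro equalityI subsetI)
    fix c
    assume "c \<in> H.sccs"
    then have c: "induced_subgraph c H" "strongly_connected c"
      by auto
    then obtain v where v: "v \<in> verts H" "verts c = {v}"
      using singleton by blast
    have "tail c = tail H" "head c = head H" "arcs c = {}"
      using c(1) assms(2) by (simp_all add: induced_subgraph_def subgraph_def compatible_def)
    then have "c = ?single v"
      using v assms(2) by (intro pre_digraph.equality) simp_all
    then show "c \<in> ?single ` verts H"
      using v by blast
  next
    fix c
    assume "c \<in> ?single ` verts H"
    then obtain v where v: "v \<in> verts H" "c = ?single v"
      by blast
    show "c \<in> H.sccs"
    proof (rule H.in_sccsI)
      show "induced_subgraph c H"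
        unfolding v(2) using v(1) by (intro H.induced_induce) simp
      show "strongly_connected c"
        unfolding strongly_connected_def reachable_def v(2) by simp
      show "\<not> (\<exists>c'. induced_subgraph c' H \<and> strongly_connected c' \<and> verts c \<subset> verts c')"
      proof
        assume "\<exists>c'. induced_subgraph c' H \<and> strongly_connected c' \<and> verts c \<subset> verts c'"
        then obtain c' where c': "induced_subgraph c' H" "strongly_connected c'" "verts c \<subset> verts c'"
          by blast
        then obtain w where "verts c' = {w}"
          using singleton by blast
        then show False
          using c'(3) v(2) by auto
      qed
    qed
  qed
  moreover have "inj_on ?single (verts H)"
    by (rule inj_on_inverseI[where g = "\<lambda>c. the_elem (verts c)"]) simp
  ultimately show ?thesis
    by (simp add: num_components_def card_image)
qed

context graph
begin

interpretation simple: adjacency "verts G" "dominates G"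
  by (rule adjacency_dominates)

text \<open>
  Deleting the complement of \<open>J\<close> leaves the elements of \<open>J\<close> as isolated vertices, so \<open>card (verts G - J) / card J\<close> is one of the
  ratios in the minimum. The graph is not complete since \<open>J\<close> contains two non-adjacent vertices.
\<close>
lemma card_indep_less_if_tough:
  assumes "1 < toughness G" "simple.indep J" "2 \<le> card J"
  shows "card J < card (verts G - J)"
proof -
  let ?A = "verts G - J"
  let ?M = "{ereal (real (card S) / real (num_components (delete_verts G S))) | S.
    S \<subseteq> verts G \<and> 2 \<le> num_components (delete_verts G S)}"
  have J: "J \<subseteq> verts G"
    using assms(2) by (simp add: simple.indep_def)
  have "delete_verts G ?A = G \<restriction> J"
    using J by (simp add: delete_verts_def double_diff)
  moreover have "arcs (G \<restriction> J) = {}"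
  proof -
    have "(tail G e, head G e) \<in> arcs_ends G" if "e \<in> arcs G" for e
      using that by (auto simp: arcs_ends_conv)
    then show ?thesis
      using assms(2) by (fastforce simp: simple.indep_def induce_subgraph_def)
  qed
  moreover have "wf_digraph (G \<restriction> J)"
    using induced_induce[OF J] by auto
  ultimately have num: "num_components (delete_verts G ?A) = card J"
    using num_components_without_arcs by fastforce
  obtain a b where ab: "a \<in> J" "b \<in> J" "a \<noteq> b"
    using assms(3) card_le_Suc0_iff_eq[of J] finite_subset[OF J] by fastforce
  have "(a, b) \<notin> arcs_ends G"
    using assms(2) ab by (simp add: simple.indep_def)
  then have "\<not> complete_digraph (card (verts G)) G"
    using ab J unfolding complete_digraph_def by blast
  then have "1 < Min ?M"
    using assms(1) by (simp add: toughness_def)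
  moreover have "finite ?M"
    by (rule finite_subset[of _ "(\<lambda>S. ereal (real (card S) / real (num_components (delete_verts G S)))) ` Pow (verts G)"]) auto
  moreover have "ereal (real (card ?A) / real (card J)) \<in> ?M"
    using num assms(3) by (intro CollectI exI[of _ ?A]) auto
  ultimately have "1 < ereal (real (card ?A) / real (card J))"
    using Min_le less_le_trans by blast
  then show ?thesis
    using assms(3) by (simp add: one_ereal_def less_divide_eq)
qed

theorem hamilton_connected_if_tough_induced_free:
  assumes "1 \<le> k"
    and "m_connected (k + 1) G"
    and "induced_free (with_proj (K2_union_kK1 k)) G"
    and "1 < toughness G"
    and "2 * k \<le> min_degree G"
  shows "hamilton_connected G"
proof -
  have conn: "simple.no_cut_of_size_le k"
    using assms(2) by (rule no_cut_if_m_connected)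
  have "\<exists>p. hamilton_path G p \<and> hd p = u \<and> last p = v"
    if uv: "u \<in> verts G" "v \<in> verts G" "u \<noteq> v" for u v
  proof -
    obtain q where q: "simple.path q" "hd q = u" "last q = v"
      using simple.path_between[OF conn uv(1,2)] by blast
    obtain p where p: "simple.path p" "hd p = u" "last p = v"
      and longest: "\<And>r. simple.path r \<Longrightarrow> hd r = u \<Longrightarrow> last r = v \<Longrightarrow> length r \<le> length p"
      using simple.longest_path_exists[OF q(1)] unfolding q(2,3) by blast
    interpret longest_path "verts G" "dominates G" p
      by unfold_locales (use p longest in \<open>simp_all\<close>)
    have len: "2 \<le> length p"
      using p uv(3) by (cases p; cases "tl p") (auto simp: simple.path_def)
    have deg: "2 * k \<le> card {y. x \<rightarrow>\<^bsub>G\<^esub> y}" if "x \<in> verts G" for x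
      using min_degree_le_card_nbrs[OF that] assms(5) by linarith
    have "set p = verts G"
      by (rule longest_path_spans[OF conn edge_dominates_if_induced_free[OF assms(3)] len assms(1)
          card_indep_less_if_tough[OF assms(4)] deg])
    then show ?thesis
      using p path_iff_vpath by (auto simp: hamilton_path_def)
  qed
  then show ?thesis
    unfolding hamilton_connected_def by blast
qed

end

theorem theorem1p9:
  fixes G :: "('a,'b) pre_digraph" and k :: nat
  assumes "k \<ge> 1"
    and "graph G"
    and "m_connected (k + 1) G"
    and "induced_free (with_proj (K2_union_kK1 k)) G"
    and "toughness G > 1"
    and "min_degree G \<ge> 2 * k"
  shows "hamilton_connected G"
  using assms by (intro graph.hamilton_connected_if_tough_induced_free)

end
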